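(* Let $n\ge 2$, let $K_n=(V,E)$ be the complete graph on the vertex set $V$ with $|V|=n$, and let $X,Y$ be two distinct cuts of $K_n$. Then the cones $K^{+}_{\min}(X)$ and $K^{+}_{\min}(Y)$ are adjacent (i.e. $\dim\big(K^{+}_{\min}(X)\cap K^{+}_{\min}(Y)\big)=d-1$, where $d=\binom{n}{2}$) if and only if $X$ and $Y$ are not crossing.
   Context: Let $d=\binom{n}{2}=|E|$. For $S\subseteq V$, the cut vector $\mathbf{v}(S)\in\{0,1\}^{d}$ has coordinates indexed by edges $\{i,j\}\in E$, with $\mathbf{v}(S)_{i,j}=1$ if $|S\cap\{i,j\}|=1$ and $0$ otherwise. A cut is a nonempty proper subset $X\subset V$, where $X$ and its complement $\bar X=V\setminus X$ are identified (they have the same cut vector); the empty cut is excluded, so there are $2^{n-1}-1$ cuts. For a cut $X$, define the convex polyhedral cone $K^{+}_{\min}(X)=\{\mathbf{c}\in\mathbb{R}^{d}:\ \mathbf{c}\ge\mathbf{0},\ \langle\mathbf{c},\mathbf{v}(X)\rangle\le\langle\mathbf{c},\mathbf{v}(Y)\rangle \text{ for all cuts } Y\}$. These cones form the cone partition of the nonnegative orthant for the min-cut problem with non-negative edge weights. Two such cones $K^{+}_{\min}(X),K^{+}_{\min}(Y)$ ($X\ne Y$) are called adjacent if $\dim\big(K^{+}_{\min}(X)\cap K^{+}_{\min}(Y)\big)=d-1$. Two subsets $A,B\subset V$ are crossing if $A\cap B\neq\emptyset$, $A\setminus B\ne\emptyset$, $B\setminus A\neq\emptyset$ and $V\setminus(A\cup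 B)\neq\emptyset$ (this property is invariant under replacing $A$ or $B$ by its complement). *)

theory Defs
  imports "HOL-Analysis.Analysis"
begin

text \<open>The vertex set \<open>V\<close> of \<open>K\<^sub>n\<close> is the universe of a type of class \<open>card2\<close>, i.e. a finite type
  with at least two elements, so that \<open>n = CARD('v) \<ge> 2\<close> and the edge type is inhabited.
  Weight vectors in \<open>\<real>\<^sup>d\<close> have type \<open>real ^ 'v edge\<close>.\<close>

typedef 'v edge = "{e :: 'v::card2 set. card e = 2}"
  morphisms endpoints Abs_edge
proof -
  have "2 \<le> card (UNIV :: 'v set)"
    by (rule two_le_card)
  then obtain e :: "'v set" where "card e = 2"
    by (meson obtain_subset_with_card_n)
  then show ?thesis
    by blast
qed

instance edge :: (card2) finite
proof
  have "inj (endpoints :: 'a edge \<Rightarrow> 'a set)"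
    by (simp add: inj_def endpoints_inject)
  then show "finite (UNIV :: 'a edge set)"
    using finite_imageD finite by blast
qed

lemma card_edge: "CARD('v edge) = CARD('v::card2) choose 2"
proof -
  have "CARD('v edge) = card {e :: 'v set. card e = 2}"
    by (rule type_definition.card[OF type_definition_edge])
  also have "\<dots> = card {e. e \<subseteq> (UNIV :: 'v set) \<and> card e = 2}"
    by simp
  also have "\<dots> = CARD('v) choose 2"
    by (rule n_subsets) simp
  finally show ?thesis .
qed

definition cut_vector :: "'v::card2 set \<Rightarrow> real ^ 'v edge" where
  "cut_vector S = (\<chi> e. if card (S \<inter> endpoints e) = 1 then 1 else 0)"

text \<open>Cuts are handled through representatives: \<open>X\<close> and \<open>- X\<close> represent the same cut.\<close>

definition is_cut :: "'v set \<Rightarrow> bool" where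
  "is_cut X \<longleftrightarrow> X \<noteq> {} \<and> X \<noteq> UNIV"

definition same_cut :: "'v set \<Rightarrow> 'v set \<Rightarrow> bool" where
  "same_cut X Y \<longleftrightarrow> X = Y \<or> X = - Y"

definition K_min_plus :: "'v::card2 set \<Rightarrow> (real ^ 'v edge) set" where
  "K_min_plus X = {c. (\<forall>e. 0 \<le> c $ e) \<and>
     (\<forall>Y. is_cut Y \<longrightarrow> c \<bullet> cut_vector X \<le> c \<bullet> cut_vector Y)}"

text \<open>The dimension of a cone is the dimension of its affine hull, an integer.\<close>

definition cones_adjacent :: "'v::card2 set \<Rightarrow> 'v set \<Rightarrow> bool" where
  "cones_adjacent X Y \<longleftrightarrow>
     aff_dim (K_min_plus X \<inter> K_min_plus Y) = int (CARD('v) choose 2) - 1"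

definition crossing :: "'v set \<Rightarrow> 'v set \<Rightarrow> bool" where
  "crossing A B \<longleftrightarrow>
     A \<inter> B \<noteq> {} \<and> A - B \<noteq> {} \<and> B - A \<noteq> {} \<and> UNIV - (A \<union> B) \<noteq> {}"

end

theory Submission imports Defs begin

text \<open>If \<open>X\<close> and \<open>Y\<close> cross and are both minimum cuts for \<open>c \<ge> 0\<close>, submodularity of the cut
  function applied to \<open>X, Y\<close> and to \<open>X, - Y\<close> forces \<open>c\<close> to vanish on the edges between \<open>X - Y\<close> and
  \<open>Y - X\<close> and on those between \<open>X \<inter> Y\<close> and the outside of \<open>X \<union> Y\<close>; two vanishing coordinates
  leave dimension at most \<open>d - 2\<close>. If they do not cross, we may assume after complementation that
  they are disjoint. Then there is a positive weight vector for which \<open>X\<close> and \<open>Y\<close> are the only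
  minimum cuts, and a neighbourhood of it in the hyperplane where the two cuts have equal weight
  lies in both cones.\<close>

section \<open>Edges, cut vectors and the weight of a cut\<close>

lemma endpoints_pairE:
  obtains u v where "u \<noteq> v" "endpoints e = {u, v}"
  using endpoints[of e] by (auto simp: card_2_iff)

lemma endpoints_Abs_edge [simp]: "u \<noteq> v \<Longrightarrow> endpoints (Abs_edge {u, v}) = {u, v}"
  by (rule Abs_edge_inverse) simp

lemma Abs_edge_endpoints: "endpoints e = {u, v} \<Longrightarrow> Abs_edge {u, v} = e"
  by (metis endpoints_inverse)

lemma card_Int_pair_eq_1_iff:
  "u \<noteq> v \<Longrightarrow> card (S \<inter> {u, v}) = 1 \<longleftrightarrow> (u \<in> S \<longleftrightarrow> v \<notin> S)"
  by (cases "u \<in> S"; cases "v \<in> S") auto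

lemma cut_vector_nth_pair:
  assumes "endpoints e = {u, v}" "u \<noteq> v"
  shows "cut_vector S $ e = (if u \<in> S \<longleftrightarrow> v \<notin> S then 1 else 0)"
  using card_Int_pair_eq_1_iff[OF assms(2), of S] assms(1) by (simp add: cut_vector_def)

lemma cut_vector_nonneg: "0 \<le> cut_vector S $ e"
  by (simp add: cut_vector_def)

lemma cut_vector_Compl [simp]: "cut_vector (- S) = cut_vector S"
proof -
  have "cut_vector (- S) $ e = cut_vector S $ e" for e
  proof -
    obtain u v where "u \<noteq> v" "endpoints e = {u, v}" by (rule endpoints_pairE)
    then show ?thesis by (simp add: cut_vector_nth_pair)
  qed
  then show ?thesis by (simp add: vec_eq_iff)
qed

lemma K_min_plus_Compl [simp]: "K_min_plus (- X) = K_min_plus X"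
  by (simp add: K_min_plus_def)

lemma is_cut_Compl [simp]: "is_cut (- X) \<longleftrightarrow> is_cut X"
  unfolding is_cut_def by auto

lemma same_cut_cut_vector: "same_cut X Y \<Longrightarrow> cut_vector X = cut_vector Y"
  by (auto simp: same_cut_def)

text \<open>The coordinate at \<open>{u, v}\<close> records whether \<open>u\<close> and
  \<open>v\<close> are separated, and the separation relation determines a set up to complement.
  This makes the hyperplane of equal weights in \<open>cones_adjacentI\<close> a genuine
  one.\<close>

lemma cut_vector_inject: "cut_vector X = cut_vector Y \<longleftrightarrow> same_cut X Y"
proof
  assume eq: "cut_vector X = cut_vector Y"
  have sep: "(u \<in> X \<longleftrightarrow> v \<notin> X) \<longleftrightarrow> (u \<in> Y \<longleftrightarrow> v \<notin> Y)" for u v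
  proof (cases "u = v")
    case False
    have "cut_vector X $ Abs_edge {u, v} = cut_vector Y $ Abs_edge {u, v}"
      by (simp add: eq)
    then show ?thesis
      using False by (simp add: cut_vector_nth_pair[of _ u v] split: if_splits)
  qed auto
  show "same_cut X Y"
    unfolding same_cut_def using sep by blast
qed (rule same_cut_cut_vector)

text \<open>A cut edge has exactly one endpoint in \<open>S\<close>, so listing that endpoint first
  matches the cut edges with \<open>S \<times> - S\<close>. In this form the weight splits into
  blocks when \<open>S\<close> and \<open>- S\<close> are unions of parts.\<close>

lemma inner_cut_vector:
  "c \<bullet> cut_vector S = (\<Sum>(u, v)\<in>S \<times> - S. c $ Abs_edge {u, v})"
proof -
  let ?E = "{e. card (S \<inter> endpoints e) = 1}"
  have "bij_betw (\<lambda>(u, v). Abs_edge {u, v}) (S \<times> - S) ?E"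
    unfolding bij_betw_def
  proof
    show "inj_on (\<lambda>(u, v). Abs_edge {u, v}) (S \<times> - S)"
    proof (rule inj_onI, clarify)
      fix u v u' v'
      assume *: "Abs_edge {u, v} = Abs_edge {u', v'}" "u \<in> S" "v \<notin> S" "u' \<in> S" "v' \<notin> S"
      then have "endpoints (Abs_edge {u, v}) = endpoints (Abs_edge {u', v'})" "u \<noteq> v" "u' \<noteq> v'"
        by auto
      then have "{u, v} = {u', v'}" by simp
      with * show "u = u' \<and> v = v'" by (auto simp: doubleton_eq_iff)
    qed
    show "(\<lambda>(u, v). Abs_edge {u, v}) ` (S \<times> - S) = ?E"
    proof (intro equalityI subsetI)
      fix e assume "e \<in> (\<lambda>(u, v). Abs_edge {u, v}) ` (S \<times> - S)"
      then obtain u v where *: "e = Abs_edge {u, v}" "u \<in> S" "v \<notin> S" by auto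
      then have "u \<noteq> v" by auto
      with * show "e \<in> ?E" using card_Int_pair_eq_1_iff[of u v S] by simp
    next
      fix e assume e: "e \<in> ?E"
      obtain u v where uv: "u \<noteq> v" "endpoints e = {u, v}" by (rule endpoints_pairE)
      then have "Abs_edge {u, v} = e" "Abs_edge {v, u} = e"
        by (auto intro!: Abs_edge_endpoints)
      moreover have "u \<in> S \<longleftrightarrow> v \<notin> S"
        using e uv card_Int_pair_eq_1_iff[of u v S] by simp
      ultimately show "e \<in> (\<lambda>(u, v). Abs_edge {u, v}) ` (S \<times> - S)"
        by (cases "u \<in> S") (auto intro: image_eqI[of _ _ "(u, v)"] image_eqI[of _ _ "(v, u)"])
    qed
  qed
  from sum.reindex_bij_betw[OF this, of "\<lambda>e. c $ e"]
  have "(\<Sum>(u, v)\<in>S \<times> - S. c $ Abs_edge {u, v}) = (\<Sum>e\<in>?E. c $ e)"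
    by (simp add: case_prod_unfold)
  also have "\<dots> = c \<bullet> cut_vector S"
    by (simp add: inner_vec_def cut_vector_def if_distrib sum.If_cases cong: if_cong)
  finally show ?thesis by simp
qed

subsection \<open>Crossing cuts\<close>

text \<open>Submodularity holds edge by edge. An edge from \<open>A - B\<close> to
  \<open>B - A\<close> is cut by both \<open>A\<close> and \<open>B\<close>, but by neither
  \<open>A \<inter> B\<close> nor \<open>A \<union> B\<close>, which leaves a surplus of twice its
  weight.\<close>

lemma cut_submodular_strengthened:
  fixes c :: "real ^ 'v::card2 edge"
  assumes nonneg: "\<And>e. 0 \<le> c $ e" and "a \<in> A - B" "b \<in> B - A"
  shows "c \<bullet> cut_vector (A \<inter> B) + c \<bullet> cut_vector (A \<union> B) + 2 * c $ Abs_edge {a, b}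
         \<le> c \<bullet> cut_vector A + c \<bullet> cut_vector B"
proof -
  define w where "w = cut_vector A + cut_vector B - cut_vector (A \<inter> B) - cut_vector (A \<union> B)"
  let ?e = "Abs_edge {a, b}"
  have w_nonneg: "0 \<le> w $ e" for e
  proof -
    obtain u v where "u \<noteq> v" "endpoints e = {u, v}" by (rule endpoints_pairE)
    then show ?thesis
      by (cases "u \<in> A"; cases "u \<in> B"; cases "v \<in> A"; cases "v \<in> B")
        (simp_all add: w_def cut_vector_nth_pair)
  qed
  have "a \<noteq> b" using assms by auto
  then have "w $ ?e = 2"
    using assms by (simp add: w_def cut_vector_nth_pair[of _ a b])
  then have "c $ ?e * 2 = c $ ?e * w $ ?e" by simp
  also have "\<dots> \<le> (\<Sum>e\<in>UNIV. c $ e * w $ e)"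
    by (rule member_le_sum) (auto simp: nonneg w_nonneg)
  also have "\<dots> = c \<bullet> w" by (simp add: inner_vec_def)
  finally show ?thesis by (simp add: w_def inner_diff_right inner_add_right)
qed

text \<open>By minimality \<open>A \<inter> B\<close> and \<open>A \<union> B\<close> weigh at least
  as much as \<open>A\<close> and \<open>B\<close>, so there is no room for the surplus in the
  strengthened inequality.\<close>

lemma common_min_weight_eq_0:
  assumes c: "c \<in> K_min_plus A" "c \<in> K_min_plus B"
    and cuts: "is_cut (A \<inter> B)" "is_cut (A \<union> B)"
    and ab: "a \<in> A - B" "b \<in> B - A"
  shows "c $ Abs_edge {a, b} = 0"
proof -
  have nonneg: "\<And>e. 0 \<le> c $ e"
    using c by (simp add: K_min_plus_def)
  have "c \<bullet> cut_vector A \<le> c \<bullet> cut_vector (A \<inter> B)" "c \<bullet> cut_vector B \<le> c \<bullet> cut_vector (A \<union> B)"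
    using c cuts by (auto simp: K_min_plus_def)
  with cut_submodular_strengthened[OF nonneg ab] nonneg[of "Abs_edge {a, b}"]
  show ?thesis by linarith
qed

lemma aff_dim_two_coords_zero:
  fixes i j :: "'n::finite"
  assumes "i \<noteq> j"
  shows "aff_dim {c :: real ^ 'n. c $ i = 0 \<and> c $ j = 0} = int CARD('n) - 2"
proof -
  let ?H = "\<lambda>k. {c :: real ^ 'n. axis k 1 \<bullet> c = 0}"
  \<comment> \<open>This vector shows that the second hyperplane does not contain the first, so that
    intersecting with it lowers the dimension once more.\<close>
  have "axis j 1 \<in> ?H i" "axis j 1 \<notin> ?H j"
    using assms by (auto simp: inner_axis_axis)
  then have "\<not> ?H i \<subseteq> ?H j" by blast
  moreover have "0 \<in> ?H i \<inter> ?H j" by simp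
  then have "?H i \<inter> ?H j \<noteq> {}" by blast
  moreover have "affine (?H i)" by (rule affine_hyperplane)
  moreover have "aff_dim (?H i) = int CARD('n) - 1"
    by (subst aff_dim_hyperplane) (auto simp: axis_eq_0_iff)
  ultimately have "aff_dim (?H i \<inter> ?H j) = int CARD('n) - 2"
    by (subst aff_dim_affine_Int_hyperplane) auto
  also have "?H i \<inter> ?H j = {c. c $ i = 0 \<and> c $ j = 0}"
    by (auto simp: inner_axis')
  finally show ?thesis .
qed

lemma crossing_not_adjacent:
  fixes X Y :: "'v::card2 set"
  assumes "crossing X Y"
  shows "\<not> cones_adjacent X Y"
proof -
  from assms obtain a b p q where
    ab: "a \<in> X - Y" "b \<in> Y - X" and pq: "p \<in> X \<inter> Y" "q \<notin> X \<union> Y"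
    unfolding crossing_def by blast
  let ?e = "Abs_edge {a, b}" and ?f = "Abs_edge {p, q}"
  have "a \<noteq> b" "p \<noteq> q" "{a, b} \<noteq> {p, q}"
    using ab pq by auto
  then have "?e \<noteq> ?f" by (metis endpoints_Abs_edge)
  have "K_min_plus X \<inter> K_min_plus Y \<subseteq> {c. c $ ?e = 0 \<and> c $ ?f = 0}"
  proof clarify
    fix c assume c: "c \<in> K_min_plus X" "c \<in> K_min_plus Y"
    have "c $ ?e = 0"
      by (rule common_min_weight_eq_0[OF c]) (use ab pq in \<open>auto simp: is_cut_def\<close>)
    \<comment> \<open>Replacing \<open>Y\<close> by \<open>- Y\<close> keeps the cone and puts
      \<open>p\<close> into \<open>X - (- Y)\<close> and \<open>q\<close> into
      \<open>- Y - X\<close>; now \<open>a\<close> and \<open>b\<close> witness that the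
      intersection and the union are cuts.\<close>
    moreover have "c $ ?f = 0"
      by (rule common_min_weight_eq_0[of _ X "- Y"]) (use c ab pq in \<open>auto simp: is_cut_def\<close>)
    ultimately show "c $ ?e = 0 \<and> c $ ?f = 0" ..
  qed
  from aff_dim_subset[OF this] show ?thesis
    by (simp add: cones_adjacent_def aff_dim_two_coords_zero[OF \<open>?e \<noteq> ?f\<close>] card_edge)
qed

subsection \<open>Non-crossing cuts\<close>

lemma K_min_plus_Int_subset_hyperplane:
  assumes "is_cut X" "is_cut Y"
  shows "K_min_plus X \<inter> K_min_plus Y \<subseteq> {c. (cut_vector X - cut_vector Y) \<bullet> c = 0}"
  using assms by (fastforce simp: K_min_plus_def inner_diff_left inner_commute[of "cut_vector _"])

text \<open>All constraints other than equality of the two weights are strict at \<open>c\<close>,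
  hence persist nearby. A nonempty relatively open piece of the hyperplane has its full
  dimension.\<close>

lemma cones_adjacentI:
  fixes X Y :: "'v::card2 set"
  assumes cuts: "is_cut X" "is_cut Y" "\<not> same_cut X Y"
    and pos: "\<And>e. 0 < c $ e"
    and eq: "c \<bullet> cut_vector X = c \<bullet> cut_vector Y"
    and less: "\<And>Z. is_cut Z \<Longrightarrow> \<not> same_cut Z X \<Longrightarrow> \<not> same_cut Z Y \<Longrightarrow>
      c \<bullet> cut_vector X < c \<bullet> cut_vector Z"
  shows "cones_adjacent X Y"
proof -
  define H where "H = {c. (cut_vector X - cut_vector Y) \<bullet> c = 0}"
  define \<Z> where "\<Z> = {Z. is_cut Z \<and> \<not> same_cut Z X \<and> \<not> same_cut Z Y}"
  define U where "U = (\<Inter>e. {c. 0 < c $ e}) \<inter>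
    (\<Inter>Z\<in>\<Z>. {c. c \<bullet> cut_vector X < c \<bullet> cut_vector Z})"
  have "cut_vector X - cut_vector Y \<noteq> 0"
    using cuts(3) by (simp add: cut_vector_inject)
  then have dim_H: "aff_dim H = int (CARD('v) choose 2) - 1"
    using aff_dim_hyperplane[of "cut_vector X - cut_vector Y" 0]
      zero_less_card_finite[where 'a = "'v edge"]
    by (simp add: H_def card_edge of_nat_diff del: zero_less_card_finite zero_less_binomial_iff)
  \<comment> \<open>There are only finitely many edges and cuts, so these are finite intersections
    of open half-spaces.\<close>
  have "open U"
    unfolding U_def
    by (auto intro!: open_Int open_INT open_Collect_less continuous_intros)
  moreover have "c \<in> H \<inter> U"
    using pos eq less by (simp add: H_def U_def \<Z>_def inner_diff_left inner_commute[of "cut_vector _"])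
  moreover have "affine H"
    unfolding H_def by (rule affine_hyperplane)
  ultimately have "aff_dim (H \<inter> U) = aff_dim H"
    by (intro aff_dim_convex_Int_open affine_imp_convex) auto
  moreover have "H \<inter> U \<subseteq> K_min_plus X \<inter> K_min_plus Y"
  proof
    fix c assume c: "c \<in> H \<inter> U"
    then have eq: "c \<bullet> cut_vector X = c \<bullet> cut_vector Y"
      by (simp add: H_def inner_diff_left inner_commute[of "cut_vector _"])
    have "c \<bullet> cut_vector X \<le> c \<bullet> cut_vector Z" if "is_cut Z" for Z
    proof (cases "Z \<in> \<Z>")
      case True
      with c show ?thesis by (auto simp: U_def intro: less_imp_le)
    next
      case False
      with that have "same_cut Z X \<or> same_cut Z Y" by (simp add: \<Z>_def)
      with eq show ?thesis by (auto dest: same_cut_cut_vector)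
    qed
    moreover have "\<forall>e. 0 \<le> c $ e"
      using c by (auto simp: U_def intro: less_imp_le)
    ultimately show "c \<in> K_min_plus X \<inter> K_min_plus Y"
      by (simp add: K_min_plus_def flip: eq)
  qed
  ultimately have "aff_dim H \<le> aff_dim (K_min_plus X \<inter> K_min_plus Y)"
    by (metis aff_dim_subset)
  moreover have "aff_dim (K_min_plus X \<inter> K_min_plus Y) \<le> aff_dim H"
    unfolding H_def by (intro aff_dim_subset K_min_plus_Int_subset_hyperplane cuts)
  ultimately show ?thesis
    by (simp add: cones_adjacent_def dim_H)
qed

lemma disjoint_cuts_adjacent:
  fixes A B :: "'v::card2 set"
  assumes cuts: "is_cut A" "is_cut B" "\<not> same_cut A B" and disj: "A \<inter> B = {}"
  shows "cones_adjacent A B"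
proof -
  define C where "C = - (A \<union> B)"
  \<comment> \<open>If \<open>C\<close> were empty, \<open>A\<close> and \<open>B\<close> would be
    complementary and thus the same cut.\<close>
  have ne: "A \<noteq> {}" "B \<noteq> {}" "C \<noteq> {}"
    using cuts disj by (auto simp: is_cut_def same_cut_def C_def)
  have disj': "A \<inter> C = {}" "B \<inter> C = {}" by (auto simp: C_def)
  have Compl: "- A = B \<union> C" "- B = A \<union> C" "- C = A \<union> B"
    using disj by (auto simp: C_def)
  have cards: "card A > 0" "card B > 0" "card C > 0"
    using ne by (auto simp: card_gt_0_iff)
  \<comment> \<open>Total weight 1 between \<open>A\<close> and \<open>B\<close>, and 2 between \<open>C\<close> and each of them, so that \<open>A\<close>, \<open>B\<close>, \<open>C\<close>
    have weights 3, 3, 4; a cut splitting one of the three parts has weight at least 4.\<close>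
  define h :: "'v set \<Rightarrow> real" where "h s =
    (if s \<subseteq> A \<or> s \<subseteq> B \<or> s \<subseteq> C then 4
     else if s \<subseteq> A \<union> B then 1 / (card A * card B)
     else if s \<subseteq> A \<union> C then 2 / (card A * card C)
     else 2 / (card B * card C))" for s
  define c :: "real ^ 'v edge" where "c = (\<chi> e. h (endpoints e))"
  have pos: "0 < c $ e" for e
    using cards by (simp add: c_def h_def)
  have weight: "c \<bullet> cut_vector S = (\<Sum>u\<in>S. \<Sum>v\<in>- S. h {u, v})" for S
  proof -
    have "c \<bullet> cut_vector S = (\<Sum>(u, v)\<in>S \<times> - S. h {u, v})"
      unfolding inner_cut_vector
    proof (intro sum.cong refl, clarify)
      fix u v assume "u \<in> S" "v \<notin> S"
      then have "u \<noteq> v" by auto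
      then show "c $ Abs_edge {u, v} = h {u, v}" by (simp add: c_def)
    qed
    then show ?thesis by (simp add: sum.cartesian_product)
  qed
  have h: "h {u, v} = 1 / (card A * card B)" "h {v, u} = 1 / (card A * card B)"
      if "u \<in> A" "v \<in> B" for u v
    using that disj disj' by (auto simp: h_def)
  have h': "h {u, v} = 2 / (card A * card C)" "h {v, u} = 2 / (card A * card C)"
      if "u \<in> A" "v \<in> C" for u v
    using that disj disj' by (auto simp: h_def)
  have h'': "h {u, v} = 2 / (card B * card C)" "h {v, u} = 2 / (card B * card C)"
      if "u \<in> B" "v \<in> C" for u v
    using that disj disj' by (auto simp: h_def)
  have wA: "c \<bullet> cut_vector A = 3"
    unfolding weight Compl using cards ne disj disj'
    by (simp add: sum.union_disjoint sum.distrib h h' field_simps)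
  have wB: "c \<bullet> cut_vector B = 3"
    unfolding weight Compl using cards ne disj disj'
    by (simp add: sum.union_disjoint sum.distrib h h'' field_simps)
  have wC: "c \<bullet> cut_vector C = 4"
    unfolding weight Compl using cards ne disj disj'
    by (simp add: sum.union_disjoint sum.distrib h' h'' field_simps)
  have split: "4 \<le> c \<bullet> cut_vector Z"
    if "P = A \<or> P = B \<or> P = C" "u \<in> P" "v \<in> P" "u \<in> Z" "v \<notin> Z" for P Z u v
  proof -
    let ?e = "Abs_edge {u, v}"
    have "u \<noteq> v" using that by auto
    then have "c $ ?e * cut_vector Z $ ?e = 4"
      using that by (auto simp: c_def h_def cut_vector_nth_pair[of _ u v])
    moreover have "c $ ?e * cut_vector Z $ ?e \<le> (\<Sum>e\<in>UNIV. c $ e * cut_vector Z $ e)"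
      by (rule member_le_sum) (auto simp: less_imp_le[OF pos] cut_vector_nonneg)
    ultimately show ?thesis by (simp add: inner_vec_def)
  qed
  show ?thesis
  proof (rule cones_adjacentI[OF cuts pos])
    show "c \<bullet> cut_vector A = c \<bullet> cut_vector B" by (simp add: wA wB)
    fix Z assume Z: "is_cut Z" "\<not> same_cut Z A" "\<not> same_cut Z B"
    show "c \<bullet> cut_vector A < c \<bullet> cut_vector Z"
    proof (cases "\<exists>P\<in>{A, B, C}. \<not> P \<subseteq> Z \<and> \<not> P \<subseteq> - Z")
      case True
      then obtain P u v where "P = A \<or> P = B \<or> P = C" "u \<in> P" "v \<in> P" "u \<in> Z" "v \<notin> Z"
        by blast
      from split[OF this] show ?thesis by (simp add: wA)
    next
      case False
      then have "Z \<inter> A = {} \<or> Z \<inter> A = A" "Z \<inter> B = {} \<or> Z \<inter> B = B" "Z \<inter> C = {} \<or> Z \<inter> C = C"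
        by blast+
      moreover have U: "A \<union> B \<union> C = UNIV" by (auto simp: C_def)
      then have "Z = Z \<inter> A \<union> Z \<inter> B \<union> Z \<inter> C" by blast
      ultimately obtain A' B' C' where "Z = A' \<union> B' \<union> C'"
        "A' = {} \<or> A' = A" "B' = {} \<or> B' = B" "C' = {} \<or> C' = C"
        by metis
      \<comment> \<open>Of the eight unions of parts, \<open>{}\<close> and \<open>UNIV\<close> are
        not cuts, and \<open>A\<close>, \<open>B\<close> and their complements are excluded by
        assumption; only \<open>C\<close> and \<open>- C\<close> remain.\<close>
      then have "same_cut Z C"
        using Z U by (elim disjE) (simp_all add: is_cut_def same_cut_def Compl)
      then show ?thesis by (simp add: same_cut_cut_vector wA wC)
    qed
  qed
qed

lemma cones_adjacent_Compl [simp]: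
  "cones_adjacent (- X) Y \<longleftrightarrow> cones_adjacent X Y"
  "cones_adjacent X (- Y) \<longleftrightarrow> cones_adjacent X Y"
  by (simp_all add: cones_adjacent_def)

theorem theorem2:
  fixes X Y :: "'v::card2 set"
  assumes "is_cut X" and "is_cut Y" and "\<not> same_cut X Y"
  shows "cones_adjacent X Y \<longleftrightarrow> \<not> crossing X Y"
proof
  show "cones_adjacent X Y \<Longrightarrow> \<not> crossing X Y"
    using crossing_not_adjacent by blast
  assume "\<not> crossing X Y"
  \<comment> \<open>Each empty quadrant is the intersection of representatives of the two cuts, and
    complementing a representative does not change its cone.\<close>
  then have "X \<inter> Y = {} \<or> X \<inter> - Y = {} \<or> - X \<inter> Y = {} \<or> - X \<inter> - Y = {}"
    unfolding crossing_def by blast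
  moreover have "\<not> same_cut X (- Y)" "\<not> same_cut (- X) Y" "\<not> same_cut (- X) (- Y)"
    using assms(3) by (auto simp: same_cut_def)
  ultimately show "cones_adjacent X Y"
    using disjoint_cuts_adjacent[of X Y] disjoint_cuts_adjacent[of X "- Y"]
      disjoint_cuts_adjacent[of "- X" Y] disjoint_cuts_adjacent[of "- X" "- Y"] assms
    by auto
qed

end
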